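(* Let $h:\mathbb R^n\to\mathbb R$ be continuously differentiable, let $S=\{x\in\mathbb R^n : h(x)\le 0\}$, and let $T>0$ be a prescribed time. Suppose there exist constants $\alpha_1,\alpha_2>0$, $\gamma_1>1$ and $0<\gamma_2<1$ satisfying $$\frac{1}{\alpha_1(\gamma_1-1)}+\frac{1}{\alpha_2(1-\gamma_2)}\le T,$$ such that $h$ is a PT CLF-$S$ for the system $\dot x=f(x)+g(x)u$ with parameters $\alpha_1,\alpha_2,\gamma_1,\gamma_2$. Then there exists a control input $u(t)\in\mathcal U$ such that the closed-loop trajectories of $\dot x=f(x)+g(x)u$ reach the set $S$ within the prescribed time $T$ for all initial conditions $x(0)\notin S$.
   Context: Consider the control-affine system $\dot x(t)=f(x(t))+g(x(t))u$, with state $x\in\mathbb R^n$, vector fields $f:\mathbb R^n\to\mathbb R^n$, $g:\mathbb R^n\to\mathbb R^{n\times m}$, and control input $u\in\mathbb R^m$ constrained to $\mathcal U=\{v\in\mathbb R^m : A_uv\le b_u\}$ (componentwise inequality), where $A_u\in\mathbb R^{l\times m}$, $b_u\in\mathbb R^l$ are given. A closed-loop trajectory is a solution $x(t)$, $t\ge 0$, of this system under the chosen control input. $L_fV=\frac{\partial V}{\partial x}f$ and $L_gV=\frac{\partial V}{\partial x}g$ denote Lie derivatives. $\partial S$ is the boundary of a closed set $S$, and $\mathrm{int}(S)=S\setminus\partial S$. Definition (PT CLF-$S$; prescribed-time control Lyapunov function). A continuously differentiable function $V:\mathbb R^n\to\mathbb R$ is called a PT CLF-$S$ for the system with parameters $a_1,a_2,b_1,b_2$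 (and prescribed time $T>0$) if it is positive definite with respect to the set $S$, i.e. $V(x)>0$ for all $x\notin S$ and $V(x)=0$ for all $x\in\partial S$, and $$\inf_{u\in\mathcal U}\{L_fV(x)+L_gV(x)u\}\le -a_1V(x)^{b_1}-a_2V(x)^{b_2}\quad\text{for all }x\notin\mathrm{int}(S),$$ where $a_1,a_2>0$, $b_1>1$, $0<b_2<1$ satisfy $\frac{1}{a_1(b_1-1)}+\frac{1}{a_2(1-b_2)}\le T$. "Reach $S$ within time $T$" means that the trajectory is in $S$ at some time $t\le T$. *)

theory Defs
  imports "HOL-Analysis.Analysis"
begin

definition continuously_differentiable :: "(real ^ 'n \<Rightarrow> real) \<Rightarrow> bool" where
  "continuously_differentiable V \<longleftrightarrow>
     (\<exists>V' :: real ^ 'n \<Rightarrow> ((real ^ 'n) \<Rightarrow>\<^sub>L real).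
        (\<forall>x. (V has_derivative blinfun_apply (V' x)) (at x)) \<and> continuous_on UNIV V')"

definition input_set :: "real ^ 'm ^ 'l \<Rightarrow> real ^ 'l \<Rightarrow> (real ^ 'm) set" where
  "input_set A b = {v. \<forall>i. (A *v v) $ i \<le> b $ i}"

definition lie_f :: "(real ^ 'n \<Rightarrow> real) \<Rightarrow> (real ^ 'n \<Rightarrow> real ^ 'n) \<Rightarrow> real ^ 'n \<Rightarrow> real" where
  "lie_f V f x = frechet_derivative V (at x) (f x)"

text \<open>The row vector \<open>L\<^sub>g V(x)\<close> has the Lie derivative along the \<open>j\<close>-th column of \<open>g\<close> as its
  \<open>j\<close>-th entry; the product with \<open>u\<close> is written as an inner product.\<close>

definition lie_g ::
  "(real ^ 'n \<Rightarrow> real) \<Rightarrow> (real ^ 'n \<Rightarrow> real ^ 'm ^ 'n) \<Rightarrow> real ^ 'n \<Rightarrow> real ^ 'm" where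
  "lie_g V g x = (\<chi> j. lie_f V (\<lambda>y. column j (g y)) x)"

text \<open>The infimum is taken in the extended reals: it is \<open>-\<infinity>\<close> when the objective is unbounded
  below on \<open>U\<close> and \<open>\<infinity>\<close> when \<open>U\<close> is empty, whereas the infimum of type
  \<^typ>\<open>real\<close> is unspecified in both cases.\<close>

definition PT_CLF ::
  "real \<Rightarrow> (real ^ 'n \<Rightarrow> real ^ 'n) \<Rightarrow> (real ^ 'n \<Rightarrow> real ^ 'm ^ 'n) \<Rightarrow> (real ^ 'm) set \<Rightarrow>
   (real ^ 'n) set \<Rightarrow> real \<Rightarrow> real \<Rightarrow> real \<Rightarrow> real \<Rightarrow> (real ^ 'n \<Rightarrow> real) \<Rightarrow> bool" where
  "PT_CLF T f g U S a1 a2 b1 b2 V \<longleftrightarrow>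
     a1 > 0 \<and> a2 > 0 \<and> b1 > 1 \<and> 0 < b2 \<and> b2 < 1 \<and>
     1 / (a1 * (b1 - 1)) + 1 / (a2 * (1 - b2)) \<le> T \<and>
     continuously_differentiable V \<and>
     (\<forall>x. x \<notin> S \<longrightarrow> V x > 0) \<and> (\<forall>x\<in>frontier S. V x = 0) \<and>
     (\<forall>x. x \<notin> interior S \<longrightarrow>
        (INF u\<in>U. ereal (lie_f V f x + lie_g V g x \<bullet> u))
          \<le> ereal (- a1 * V x powr b1 - a2 * V x powr b2))"

text \<open>Solutions on \<open>[0,\<infinity>)\<close> of \<open>x' = f(x) + g(x) u(t)\<close>. No regularity of \<open>f\<close>, \<open>g\<close> or \<open>u\<close> is
  available, so the equation is read in integrated form with the gauge integral. This admits every
  classical solution (\<open>classical_imp_trajectory\<close> below) and every Caratheodory solution,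
  i.e. locally absolutely continuous with the equation holding almost everywhere.\<close>

definition trajectory ::
  "(real ^ 'n \<Rightarrow> real ^ 'n) \<Rightarrow> (real ^ 'n \<Rightarrow> real ^ 'm ^ 'n) \<Rightarrow> (real \<Rightarrow> real ^ 'm) \<Rightarrow>
   (real \<Rightarrow> real ^ 'n) \<Rightarrow> bool" where
  "trajectory f g u x \<longleftrightarrow>
     (\<forall>t\<ge>0. ((\<lambda>s. f (x s) + g (x s) *v u s) has_integral (x t - x 0)) {0..t})"

lemma classical_imp_trajectory:
  assumes "\<And>t. t \<ge> 0 \<Longrightarrow>
    (x has_vector_derivative (f (x t) + g (x t) *v u t)) (at t within {0..})"
  shows "trajectory f g u x"
  unfolding trajectory_def
proof (intro allI impI)
  fix t :: real
  assume "t \<ge> 0"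
  then show "((\<lambda>s. f (x s) + g (x s) *v u s) has_integral (x t - x 0)) {0..t}"
  proof (rule fundamental_theorem_of_calculus)
    fix s assume "s \<in> {0..t}"
    then show "(x has_vector_derivative (f (x s) + g (x s) *v u s)) (at s within {0..t})"
      using assms[of s] by (auto intro: has_vector_derivative_within_subset)
  qed
qed

end

theory Submission
  imports Defs
begin

text \<open>
  Since the infimum in the CLF condition is at most \<open>- \<alpha>\<^sub>1 h\<^bsup>\<gamma>\<^sub>1\<^esup> - \<alpha>\<^sub>2 h\<^bsup>\<gamma>\<^sub>2\<^esup>\<close>, outside \<open>S\<close> some
  admissible input makes the derivative of \<open>h\<close> along the flow at most each of \<open>- \<alpha>\<^sub>1 h\<^bsup>\<gamma>\<^sub>1\<^esup>\<close> and
  \<open>- \<alpha>\<^sub>2 h\<^bsup>\<gamma>\<^sub>2\<^esup>\<close>. Giving up the sum of the two rates leaves room for an input that only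
  approximates the infimum, so its attainment is never needed, and it does not affect the time
  bound: the first rate brings \<open>h\<close> from any height below \<open>1\<close> within time \<open>1/(\<alpha>\<^sub>1(\<gamma>\<^sub>1 - 1))\<close>, and the
  second brings it from \<open>1\<close> to \<open>0\<close> within time \<open>1/(\<alpha>\<^sub>2(1 - \<gamma>\<^sub>2))\<close>. As trajectories are only indefinite
  gauge integrals, differentiating \<open>h\<close> along them requires a chain rule for the gauge integral.
\<close>

text \<open>On a short interval with endpoints \<open>u\<close>, \<open>v\<close> and tag
  \<open>t\<close>, the increment \<open>G (x v) - G (x u)\<close> is nearly
  \<open>G' (x t) (x v - x u)\<close> by continuity of \<open>G'\<close>, and
  \<open>x v - x u\<close> is nearly \<open>(v - u) *\<^sub>R F t\<close>, with the sum of these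
  errors controlled by Henstock's lemma. Over a tagged division the increments of \<open>G\<close>
  along \<open>x\<close> telescope.\<close>

lemma has_integral_chain_rule:
  fixes x :: "real \<Rightarrow> 'a::euclidean_space" and G :: "'a \<Rightarrow> 'b::real_normed_vector"
    and G' :: "'a \<Rightarrow> 'a \<Rightarrow>\<^sub>L 'b"
  assumes "a \<le> b"
    and F: "\<And>u v. a \<le> u \<Longrightarrow> u \<le> v \<Longrightarrow> v \<le> b \<Longrightarrow> (F has_integral (x v - x u)) {u..v}"
    and "open X" and xX: "\<And>t. t \<in> {a..b} \<Longrightarrow> x t \<in> X"
    and G: "\<And>y. y \<in> X \<Longrightarrow> (G has_derivative blinfun_apply (G' y)) (at y)"
    and G': "continuous_on X G'"
  shows "((\<lambda>s. blinfun_apply (G' (x s)) (F s)) has_integral (G (x b) - G (x a))) {a..b}"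
  unfolding has_integral_real
proof (intro allI impI)
  fix e :: real
  assume e: "e > 0"
  have Fint: "F integrable_on {a..b}"
    using F[of a b] \<open>a \<le> b\<close> by auto
  have contx: "continuous_on {a..b} x"
  proof (rule continuous_on_eq)
    show "continuous_on {a..b} (\<lambda>t. x a + integral {a..t} F)"
      by (intro continuous_intros indefinite_integral_continuous_1 Fint)
    show "x a + integral {a..t} F = x t" if "t \<in> {a..b}" for t
      using integral_unique[OF F[of a t]] that by auto
  qed
  have "continuous_on {a..b} (\<lambda>t. G' (x t))"
    by (rule continuous_on_compose2[OF G' contx]) (use xX in auto)
  then have "bounded ((\<lambda>t. G' (x t)) ` {a..b})"
    by (intro compact_imp_bounded compact_continuous_image) auto
  then obtain M where "M > 0" and M: "\<And>t. t \<in> {a..b} \<Longrightarrow> norm (G' (x t)) \<le> M"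
    unfolding bounded_pos by auto
  \<comment> \<open>Summed over a division, the errors \<open>\<epsilon> * (v - u)\<close> use up at
    most \<open>e / 2\<close>; the \<open>+ 1\<close> covers the case \<open>a = b\<close>.\<close>
  define \<epsilon> where "\<epsilon> = e / (2 * (b - a + 1))"
  have "\<epsilon> > 0"
    using e \<open>a \<le> b\<close> by (auto simp: \<epsilon>_def)
  \<comment> \<open>\<open>F\<close> need not be absolutely integrable, so the linearization error \<open>\<eta> t * norm (F t)\<close> is
    controlled pointwise, by a gauge that depends on \<open>norm (F t)\<close>.\<close>
  define \<eta> where "\<eta> t = min 1 (\<epsilon> / (1 + norm (F t)))" for t
  have \<eta>: "\<eta> t > 0" "\<eta> t \<le> 1" "\<eta> t * norm (F t) \<le> \<epsilon>" for t
  proof -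
    have p: "1 + norm (F t) > 0"
      by (simp add: add_pos_nonneg)
    then show "\<eta> t > 0" "\<eta> t \<le> 1"
      using \<open>\<epsilon> > 0\<close> by (auto simp: \<eta>_def)
    have "\<eta> t * norm (F t) \<le> \<epsilon> / (1 + norm (F t)) * norm (F t)"
      by (intro mult_right_mono) (auto simp: \<eta>_def)
    also have "\<dots> \<le> \<epsilon>"
      using p \<open>\<epsilon> > 0\<close> by (simp add: divide_simps)
    finally show "\<eta> t * norm (F t) \<le> \<epsilon>" .
  qed
  \<comment> \<open>Neither endpoint has to be the tag, so differentiability at \<open>x t\<close>
    alone would not give an error proportional to \<open>norm (x v - x u)\<close>. Continuity of
    \<open>G'\<close> and the mean value inequality on a convex ball around \<open>x t\<close>
    do.\<close>
  have "\<exists>d>0. \<forall>u\<in>{a..b} \<inter> ball t d. \<forall>v\<in>{a..b} \<inter> ball t d.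
      norm (G (x v) - G (x u) - G' (x t) (x v - x u)) \<le> norm (x v - x u) * \<eta> t"
    if t: "t \<in> {a..b}" for t
  proof -
    obtain r1 where r1: "r1 > 0" "ball (x t) r1 \<subseteq> X"
      using \<open>open X\<close> xX[OF t] open_contains_ball by blast
    obtain r2 where r2: "r2 > 0"
      "\<And>y. y \<in> X \<Longrightarrow> dist y (x t) < r2 \<Longrightarrow> dist (G' y) (G' (x t)) < \<eta> t"
      using G' xX[OF t] \<eta>(1)[of t] unfolding continuous_on_iff by metis
    define B where "B = ball (x t) (min r1 r2)"
    have B: "convex B" "x t \<in> B" "B \<subseteq> X"
      using r1 r2(1) by (auto simp: B_def)
    have B': "norm (G' y - G' (x t)) \<le> \<eta> t" if "y \<in> B" for y
    proof -
      have "y \<in> X" "dist y (x t) < r2"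
        using that B(3) by (auto simp: B_def dist_commute)
      from r2(2)[OF this] show ?thesis
        by (simp add: dist_norm)
    qed
    obtain d where d: "d > 0" "\<And>s. s \<in> {a..b} \<Longrightarrow> dist s t < d \<Longrightarrow> dist (x s) (x t) < min r1 r2"
      using contx[unfolded continuous_on_iff, rule_format, OF t, of "min r1 r2"] r1(1) r2(1) by auto
    have "norm (G (x v) - G (x u) - G' (x t) (x v - x u)) \<le> norm (x v - x u) * \<eta> t"
      if "u \<in> {a..b} \<inter> ball t d" "v \<in> {a..b} \<inter> ball t d" for u v
    proof (rule differentiable_bound_linearization[where S = B and f' = "\<lambda>y. blinfun_apply (G' y)"])
      have uv: "x u \<in> B" "x v \<in> B"
        using d(2)[of u] d(2)[of v] that by (auto simp: B_def dist_commute)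
      show "x u + s *\<^sub>R (x v - x u) \<in> B" if "s \<in> {0..1}" for s
        using convexD_alt[OF B(1) uv, of s] that by (simp add: algebra_simps)
      show "(G has_derivative blinfun_apply (G' y)) (at y within B)" if "y \<in> B" for y
        using G that B(3) by (blast intro: has_derivative_at_withinI)
      show "onorm (blinfun_apply (G' y) - blinfun_apply (G' (x t))) \<le> \<eta> t" if "y \<in> B" for y
        using B'[OF that] by (simp add: norm_blinfun.rep_eq minus_blinfun.rep_eq fun_diff_def)
    qed (fact B(2))
    with d(1) show ?thesis by blast
  qed
  then obtain d where d: "\<And>t. t \<in> {a..b} \<Longrightarrow> d t > 0"
    "\<And>t u v. \<lbrakk>t \<in> {a..b}; u \<in> {a..b} \<inter> ball t (d t); v \<in> {a..b} \<inter> ball t (d t)\<rbrakk> \<Longrightarrow>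
      norm (G (x v) - G (x u) - G' (x t) (x v - x u)) \<le> norm (x v - x u) * \<eta> t"
    by metis
  define d' where "d' t = (if t \<in> {a..b} then d t else 1)" for t
  \<comment> \<open>Each Henstock error enters \<open>1 + M\<close> times: \<open>M\<close> from
    applying \<open>G' (x t)\<close> to it, and \<open>1\<close> from the linearization error, where
    \<open>\<eta> t \<le> 1\<close>.\<close>
  have "e / (2 * (1 + M)) > 0"
    using e \<open>M > 0\<close> by simp
  then obtain \<gamma> where "gauge \<gamma>" and \<gamma>: "\<And>p. \<lbrakk>p tagged_partial_division_of {a..b}; \<gamma> fine p\<rbrakk> \<Longrightarrow>
      (\<Sum>(t,K)\<in>p. norm (measure lborel K *\<^sub>R F t - integral K F)) < e / (2 * (1 + M))"
    using Henstock_lemma[of F a b "e / (2 * (1 + M))"] Fint unfolding box_real by blast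
  show "\<exists>\<gamma>. gauge \<gamma> \<and> (\<forall>p. p tagged_division_of {a..b} \<and> \<gamma> fine p \<longrightarrow>
      norm ((\<Sum>(t,K)\<in>p. measure lborel K *\<^sub>R blinfun_apply (G' (x t)) (F t)) - (G (x b) - G (x a))) < e)"
  proof (intro exI[of _ "\<lambda>t. \<gamma> t \<inter> ball t (d' t)"] conjI allI impI)
    show "gauge (\<lambda>t. \<gamma> t \<inter> ball t (d' t))"
      using \<open>gauge \<gamma>\<close> d(1) by (intro gauge_Int gauge_ball_dependent) (auto simp: d'_def)
  next
    fix p
    assume p: "p tagged_division_of {a..b} \<and> (\<lambda>t. \<gamma> t \<inter> ball t (d' t)) fine p"
    then have ptag: "p tagged_division_of {a..b}" and fine: "\<gamma> fine p" "(\<lambda>t. ball t (d' t)) fine p"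
      by (auto simp: fine_Int)
    define err where "err t K = norm (measure lborel K *\<^sub>R F t - integral K F)" for t K
    have piece: "norm (measure lborel K *\<^sub>R blinfun_apply (G' (x t)) (F t) - (G (x (Sup K)) - G (x (Inf K))))
        \<le> \<epsilon> * (Sup K - Inf K) + (1 + M) * err t K" if tK: "(t, K) \<in> p" for t K
    proof -
      obtain u v where K: "K = {u..v}"
        using tagged_division_ofD(4)[OF ptag tK] by auto
      have "t \<in> K" "K \<subseteq> {a..b}"
        using tagged_division_ofD(2,3)[OF ptag tK] by auto
      then have uv: "u \<le> v" "a \<le> u" "v \<le> b" and t: "t \<in> {a..b}"
        by (auto simp: K)
      have "K \<subseteq> ball t (d t)"
        using fineD[OF fine(2) tK] t by (simp add: d'_def)
      then have "u \<in> ball t (d t)" "v \<in> ball t (d t)"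
        using uv by (auto simp: K)
      then have lin: "norm (G (x v) - G (x u) - G' (x t) (x v - x u)) \<le> norm (x v - x u) * \<eta> t"
        using uv t by (intro d(2)) auto
      have err: "err t K = norm ((v - u) *\<^sub>R F t - (x v - x u))"
        using integral_unique[OF F[OF uv(2,1,3)]] uv by (simp add: err_def K)
      have "norm (x v - x u) \<le> norm ((v - u) *\<^sub>R F t) + err t K"
        unfolding err by (metis norm_triangle_sub norm_minus_commute)
      then have "norm (x v - x u) * \<eta> t \<le> ((v - u) * norm (F t) + err t K) * \<eta> t"
        using \<eta>(1)[of t] uv by (intro mult_right_mono) auto
      also have "\<dots> = (v - u) * (\<eta> t * norm (F t)) + err t K * \<eta> t"
        by (simp add: algebra_simps)
      also have "\<dots> \<le> (v - u) * \<epsilon> + err t K * 1"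
        using \<eta>[of t] uv by (intro add_mono mult_left_mono) (auto simp: err_def)
      finally have 1: "norm (G (x v) - G (x u) - G' (x t) (x v - x u)) \<le> (v - u) * \<epsilon> + err t K"
        using lin by simp
      have "norm (G' (x t) ((v - u) *\<^sub>R F t - (x v - x u))) \<le> norm (G' (x t)) * err t K"
        unfolding err by (rule norm_blinfun)
      also have "\<dots> \<le> M * err t K"
        using M[OF t] by (intro mult_right_mono) (auto simp: err_def)
      finally have 2: "norm (G' (x t) ((v - u) *\<^sub>R F t - (x v - x u))) \<le> M * err t K" .
      have "(v - u) *\<^sub>R blinfun_apply (G' (x t)) (F t) - (G (x v) - G (x u))
          = G' (x t) ((v - u) *\<^sub>R F t - (x v - x u)) - (G (x v) - G (x u) - G' (x t) (x v - x u))"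
        by (simp add: blinfun.bilinear_simps)
      then have "norm ((v - u) *\<^sub>R blinfun_apply (G' (x t)) (F t) - (G (x v) - G (x u)))
          \<le> M * err t K + ((v - u) * \<epsilon> + err t K)"
        using norm_triangle_ineq4 1 2 by (smt (verit))
      then show ?thesis
        using uv by (simp add: K algebra_simps)
    qed
    have tele: "G (x b) - G (x a) = (\<Sum>(t,K)\<in>p. G (x (Sup K)) - G (x (Inf K)))"
      using additive_tagged_division_1[OF \<open>a \<le> b\<close> ptag, of "\<lambda>t. G (x t)"] by simp
    have "norm ((\<Sum>(t,K)\<in>p. measure lborel K *\<^sub>R blinfun_apply (G' (x t)) (F t)) - (G (x b) - G (x a)))
        = norm (\<Sum>(t,K)\<in>p. measure lborel K *\<^sub>R blinfun_apply (G' (x t)) (F t)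
            - (G (x (Sup K)) - G (x (Inf K))))"
      unfolding tele by (simp add: sum_subtractf split_def)
    also have "\<dots> \<le> (\<Sum>(t,K)\<in>p. \<epsilon> * (Sup K - Inf K) + (1 + M) * err t K)"
      using piece by (intro sum_norm_le) auto
    also have "\<dots> = \<epsilon> * (\<Sum>(t,K)\<in>p. Sup K - Inf K) + (1 + M) * (\<Sum>(t,K)\<in>p. err t K)"
      by (simp add: sum.distrib sum_distrib_left split_def)
    also have "(\<Sum>(t,K)\<in>p. Sup K - Inf K) = b - a"
      using additive_tagged_division_1[OF \<open>a \<le> b\<close> ptag, of "\<lambda>t. t"] by simp
    also have "\<epsilon> * (b - a) + (1 + M) * (\<Sum>(t,K)\<in>p. err t K) < e / 2 + e / 2"
    proof (rule add_le_less_mono)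
      show "\<epsilon> * (b - a) \<le> e / 2"
        using e \<open>a \<le> b\<close> by (simp add: \<epsilon>_def divide_simps)
      have "p tagged_partial_division_of {a..b}"
        using ptag by (simp add: tagged_division_of_def)
      from \<gamma>[OF this fine(1)] show "(1 + M) * (\<Sum>(t,K)\<in>p. err t K) < e / 2"
        using \<open>M > 0\<close> by (simp add: err_def field_simps)
    qed
    finally show "norm ((\<Sum>(t,K)\<in>p. measure lborel K *\<^sub>R blinfun_apply (G' (x t)) (F t))
        - (G (x b) - G (x a))) < e"
      by simp
  qed
qed

text \<open>The function \<open>v powr (1 - \<beta>) / (c * (1 - \<beta>))\<close> is an
  antiderivative of \<open>1 / (c * v powr \<beta>)\<close>, so composed with \<open>h\<close> it
  has derivative at most -1 along \<open>x\<close>. Both signs of \<open>1 - \<beta>\<close> are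
  covered, since both rates of the CLF condition are used.\<close>

lemma decay_along_trajectory:
  fixes x :: "real \<Rightarrow> 'a::euclidean_space" and h :: "'a \<Rightarrow> real"
    and h' :: "'a \<Rightarrow> 'a \<Rightarrow>\<^sub>L real"
  assumes "a \<le> b"
    and F: "\<And>u v. a \<le> u \<Longrightarrow> u \<le> v \<Longrightarrow> v \<le> b \<Longrightarrow> (F has_integral (x v - x u)) {u..v}"
    and h: "\<And>y. (h has_derivative blinfun_apply (h' y)) (at y)"
    and h': "continuous_on UNIV h'"
    and pos: "\<And>t. t \<in> {a..b} \<Longrightarrow> h (x t) > 0"
    and dec: "\<And>t. t \<in> {a..b} \<Longrightarrow> h' (x t) (F t) \<le> - c * h (x t) powr \<beta>"
    and "c > 0" "\<beta> \<noteq> 1"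
  shows "h (x b) powr (1 - \<beta>) / (c * (1 - \<beta>)) \<le> h (x a) powr (1 - \<beta>) / (c * (1 - \<beta>)) - (b - a)"
proof -
  \<comment> \<open>The antiderivative is differentiable only at positive arguments, hence the chain
    rule is applied on this open set.\<close>
  define X where "X = {y. h y > 0}"
  define P where "P v = v powr (1 - \<beta>) / (c * (1 - \<beta>))" for v
  define G' where "G' y = (1 / (c * h y powr \<beta>)) *\<^sub>R h' y" for y
  have conth: "continuous_on A h" for A
    using h has_derivative_continuous by (blast intro: continuous_at_imp_continuous_on)
  have "((\<lambda>s. blinfun_apply (G' (x s)) (F s)) has_integral (P (h (x b)) - P (h (x a)))) {a..b}"
  proof (rule has_integral_chain_rule[where X = X and G = "\<lambda>y. P (h y)"])
    show "open X"
      unfolding X_def by (intro open_Collect_less conth continuous_on_const)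
    show "continuous_on X G'"
      unfolding G'_def
      by (intro continuous_intros conth continuous_on_subset[OF h'])
        (use \<open>c > 0\<close> in \<open>auto simp: X_def\<close>)
    show "((\<lambda>y. P (h y)) has_derivative blinfun_apply (G' y)) (at y)" if "y \<in> X" for y
    proof -
      have "h y > 0" using that by (simp add: X_def)
      then have "(P has_real_derivative (1 - \<beta>) * h y powr (1 - \<beta> - 1) / (c * (1 - \<beta>))) (at (h y))"
        unfolding P_def by (intro DERIV_cdivide has_real_derivative_powr)
      also have "(1 - \<beta>) * h y powr (1 - \<beta> - 1) / (c * (1 - \<beta>)) = 1 / (c * h y powr \<beta>)"
        using \<open>\<beta> \<noteq> 1\<close> by (simp add: powr_minus_divide)
      finally have "(P has_real_derivative 1 / (c * h y powr \<beta>)) (at (h y))" .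
      from has_derivative_compose[OF h this[unfolded has_field_derivative_def]]
      show ?thesis by (simp add: G'_def scaleR_blinfun.rep_eq)
    qed
  qed (use assms in \<open>auto simp: X_def\<close>)
  then have "P (h (x b)) - P (h (x a)) \<le> - 1 * (b - a)"
  proof (rule has_integral_le)
    show "((\<lambda>t. - 1) has_integral - 1 * (b - a)) {a..b}"
      using has_integral_const_real[of "- 1 :: real" a b] \<open>a \<le> b\<close> by simp
    show "blinfun_apply (G' (x t)) (F t) \<le> - 1" if "t \<in> {a..b}" for t
    proof -
      have "c * h (x t) powr \<beta> > 0"
        using pos[OF that] \<open>c > 0\<close> by simp
      then show ?thesis
        using dec[OF that] by (simp add: G'_def scaleR_blinfun.rep_eq divide_simps)
    qed
  qed
  then show ?thesis by (simp add: P_def)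
qed

lemma trajectory_has_integral:
  assumes "trajectory f g u x" and "0 \<le> r" "r \<le> s"
  shows "((\<lambda>t. f (x t) + g (x t) *v u t) has_integral (x s - x r)) {r..s}"
proof -
  let ?F = "\<lambda>t. f (x t) + g (x t) *v u t"
  have 0: "(?F has_integral (x t - x 0)) {0..t}" if "t \<ge> 0" for t
    using assms(1) that by (simp add: trajectory_def)
  have "?F integrable_on {r..s}"
    using 0[of s] assms by (auto intro: integrable_subinterval_real)
  then have "(?F has_integral integral {r..s} ?F) {r..s}"
    by (rule integrable_integral)
  moreover have "integral {0..r} ?F + integral {r..s} ?F = integral {0..s} ?F"
    using assms(2,3) 0[of s, THEN has_integral_integrable] by (intro Henstock_Kurzweil_Integration.integral_combine) auto
  then have "integral {r..s} ?F = x s - x r"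
    using integral_unique[OF 0[of r]] integral_unique[OF 0[of s]] assms
    by (simp add: algebra_simps)
  ultimately show ?thesis by simp
qed

lemma lie_f_add_lie_g:
  assumes "(V has_derivative D) (at x)"
  shows "lie_f V f x + lie_g V g x \<bullet> u = D (f x + g x *v u)"
proof -
  have D: "frechet_derivative V (at x) = D"
    using frechet_derivative_at[OF assms] by simp
  interpret D: bounded_linear D
    using assms by (rule has_derivative_bounded_linear)
  show ?thesis
    by (simp add: lie_f_def lie_g_def D inner_vec_def matrix_mult_sum D.add D.sum
        scalar_mult_eq_scaleR D.scaleR mult.commute)
qed

theorem theorem2:
  fixes f :: "real ^ 'n \<Rightarrow> real ^ 'n"
    and g :: "real ^ 'n \<Rightarrow> real ^ 'm ^ 'n"
    and A\<^sub>u :: "real ^ 'm ^ 'l" and b\<^sub>u :: "real ^ 'l"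
    and h :: "real ^ 'n \<Rightarrow> real"
    and S :: "(real ^ 'n) set"
    and T \<alpha>\<^sub>1 \<alpha>\<^sub>2 \<gamma>\<^sub>1 \<gamma>\<^sub>2 :: real
  assumes "continuously_differentiable h"
    and "S = {x. h x \<le> 0}"
    and "T > 0"
    and "\<alpha>\<^sub>1 > 0" and "\<alpha>\<^sub>2 > 0" and "\<gamma>\<^sub>1 > 1" and "0 < \<gamma>\<^sub>2" and "\<gamma>\<^sub>2 < 1"
    and "1 / (\<alpha>\<^sub>1 * (\<gamma>\<^sub>1 - 1)) + 1 / (\<alpha>\<^sub>2 * (1 - \<gamma>\<^sub>2)) \<le> T"
    and "PT_CLF T f g (input_set A\<^sub>u b\<^sub>u) S \<alpha>\<^sub>1 \<alpha>\<^sub>2 \<gamma>\<^sub>1 \<gamma>\<^sub>2 h"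
  shows "\<exists>k :: real ^ 'n \<Rightarrow> real ^ 'm. \<forall>x\<^sub>0. x\<^sub>0 \<notin> S \<longrightarrow>
           (\<forall>y. k y \<in> input_set A\<^sub>u b\<^sub>u) \<and>
           (\<forall>x. x 0 = x\<^sub>0 \<and> trajectory f g (\<lambda>t. k (x t)) x \<longrightarrow> (\<exists>t\<in>{0..T}. x t \<in> S))"
proof -
  obtain h' :: "real ^ 'n \<Rightarrow> (real ^ 'n) \<Rightarrow>\<^sub>L real" where
    h: "\<And>y. (h has_derivative blinfun_apply (h' y)) (at y)" and h': "continuous_on UNIV h'"
    using assms(1) by (auto simp: continuously_differentiable_def)
  let ?U = "input_set A\<^sub>u b\<^sub>u"
  define ok where "ok y u \<longleftrightarrow> u \<in> ?U \<and> h' y (f y + g y *v u) \<le> - \<alpha>\<^sub>1 * h y powr \<gamma>\<^sub>1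
      \<and> h' y (f y + g y *v u) \<le> - \<alpha>\<^sub>2 * h y powr \<gamma>\<^sub>2" for y u
  have ex_ok: "\<exists>u. ok y u" if "y \<notin> S" for y
  proof -
    have "h y > 0"
      using that assms(2) by simp
    then have p: "\<alpha>\<^sub>1 * h y powr \<gamma>\<^sub>1 > 0" "\<alpha>\<^sub>2 * h y powr \<gamma>\<^sub>2 > 0"
      using assms by auto
    have "y \<notin> interior S"
      using that interior_subset by blast
    then have "(INF u\<in>?U. ereal (lie_f h f y + lie_g h g y \<bullet> u))
        \<le> ereal (- \<alpha>\<^sub>1 * h y powr \<gamma>\<^sub>1 - \<alpha>\<^sub>2 * h y powr \<gamma>\<^sub>2)"
      using assms(10) by (simp add: PT_CLF_def)
    \<comment> \<open>A sum of two positive numbers exceeds their maximum. This strict gap yields an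
      actual input below the bound, even if the infimum is not attained or is minus
      infinity.\<close>
    also have "\<dots> < ereal (- max (\<alpha>\<^sub>1 * h y powr \<gamma>\<^sub>1) (\<alpha>\<^sub>2 * h y powr \<gamma>\<^sub>2))"
      using p by auto
    finally obtain u where "u \<in> ?U" and
      "lie_f h f y + lie_g h g y \<bullet> u < - max (\<alpha>\<^sub>1 * h y powr \<gamma>\<^sub>1) (\<alpha>\<^sub>2 * h y powr \<gamma>\<^sub>2)"
      unfolding INF_less_iff by auto
    then have "ok y u"
      unfolding ok_def lie_f_add_lie_g[OF h] by auto
    then show ?thesis ..
  qed
  define k where "k y = (SOME u. u \<in> ?U \<and> (y \<notin> S \<longrightarrow> ok y u))" for y
  \<comment> \<open>On \<open>S\<close> any admissible input will do, but one must exist. A point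
    outside \<open>S\<close> provides it through \<open>ex_ok\<close>; if \<open>S\<close> is the
    whole space, \<open>?U\<close> may be empty.\<close>
  have k: "k y \<in> ?U" "y \<notin> S \<Longrightarrow> ok y (k y)" if x\<^sub>0: "x\<^sub>0 \<notin> S" for x\<^sub>0 y
  proof -
    obtain u\<^sub>0 where "ok x\<^sub>0 u\<^sub>0"
      using ex_ok[OF x\<^sub>0] by blast
    then have "\<exists>u. u \<in> ?U \<and> (y \<notin> S \<longrightarrow> ok y u)"
      using ex_ok[of y] unfolding ok_def by blast
    from someI_ex[OF this] show "k y \<in> ?U" "y \<notin> S \<Longrightarrow> ok y (k y)"
      unfolding k_def by auto
  qed
  have "\<exists>t\<in>{0..T}. x t \<in> S" if "x 0 \<notin> S" and traj: "trajectory f g (\<lambda>t. k (x t)) x" for x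
  proof (rule ccontr)
    assume "\<not> (\<exists>t\<in>{0..T}. x t \<in> S)"
    then have out: "x t \<notin> S" if "t \<in> {0..T}" for t
      using that by blast
    then have pos: "h (x t) > 0" if "t \<in> {0..T}" for t
      using that assms(2) by force
    define T\<^sub>1 where "T\<^sub>1 = 1 / (\<alpha>\<^sub>1 * (\<gamma>\<^sub>1 - 1))"
    define T\<^sub>2 where "T\<^sub>2 = 1 / (\<alpha>\<^sub>2 * (1 - \<gamma>\<^sub>2))"
    have T: "T\<^sub>1 > 0" "T\<^sub>2 > 0" "T\<^sub>1 + T\<^sub>2 \<le> T"
      using assms by (auto simp: T\<^sub>1_def T\<^sub>2_def)
    have dec: "h' (x t) (f (x t) + g (x t) *v k (x t)) \<le> - \<alpha>\<^sub>1 * h (x t) powr \<gamma>\<^sub>1"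
      "h' (x t) (f (x t) + g (x t) *v k (x t)) \<le> - \<alpha>\<^sub>2 * h (x t) powr \<gamma>\<^sub>2"
      if "t \<in> {0..T}" for t
      using k(2)[OF \<open>x 0 \<notin> S\<close> out[OF that]] by (auto simp: ok_def)
    \<comment> \<open>Since \<open>1 - \<gamma>\<^sub>1\<close> is negative, the decay bound says
      that \<open>h powr (1 - \<gamma>\<^sub>1)\<close> grows by at least 1 up to time
      \<open>T\<^sub>1\<close>. Being positive at the start, it then exceeds 1, so \<open>h\<close>
      is below 1 whatever the initial state.\<close>
    have "h (x T\<^sub>1) powr (1 - \<gamma>\<^sub>1) / (\<alpha>\<^sub>1 * (1 - \<gamma>\<^sub>1))
        \<le> h (x 0) powr (1 - \<gamma>\<^sub>1) / (\<alpha>\<^sub>1 * (1 - \<gamma>\<^sub>1)) - (T\<^sub>1 - 0)"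
      by (rule decay_along_trajectory[OF _ trajectory_has_integral[OF traj] h h'])
        (use T assms pos dec in auto)
    moreover have "v / (\<alpha>\<^sub>1 * (1 - \<gamma>\<^sub>1)) = - (v * T\<^sub>1)" for v
      using assms by (simp add: T\<^sub>1_def divide_simps) (simp add: algebra_simps)
    ultimately have "(h (x 0) powr (1 - \<gamma>\<^sub>1) + 1) * T\<^sub>1 \<le> h (x T\<^sub>1) powr (1 - \<gamma>\<^sub>1) * T\<^sub>1"
      by (simp add: algebra_simps)
    then have "h (x 0) powr (1 - \<gamma>\<^sub>1) + 1 \<le> h (x T\<^sub>1) powr (1 - \<gamma>\<^sub>1)"
      using T by simp
    moreover have "h (x 0) powr (1 - \<gamma>\<^sub>1) > 0"
      using pos[of 0] assms by simp
    ultimately have "h (x T\<^sub>1) powr (1 - \<gamma>\<^sub>1) > 1" by linarith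
    then have "h (x T\<^sub>1) < 1"
      using powr_mono[of "1 - \<gamma>\<^sub>1" 0 "h (x T\<^sub>1)"] assms(6) by (cases "h (x T\<^sub>1) < 1") auto
    then have less1: "h (x T\<^sub>1) powr (1 - \<gamma>\<^sub>2) < 1"
      using powr_less_mono2[of "1 - \<gamma>\<^sub>2" "h (x T\<^sub>1)" 1] pos[of T\<^sub>1] T assms by simp
    \<comment> \<open>The remaining time is at least \<open>T\<^sub>2\<close>, in which
      \<open>h powr (1 - \<gamma>\<^sub>2)\<close> would have to drop by at least 1 from a value
      below 1, although powers are nonnegative.\<close>
    have "h (x T) powr (1 - \<gamma>\<^sub>2) / (\<alpha>\<^sub>2 * (1 - \<gamma>\<^sub>2))
        \<le> h (x T\<^sub>1) powr (1 - \<gamma>\<^sub>2) / (\<alpha>\<^sub>2 * (1 - \<gamma>\<^sub>2)) - (T - T\<^sub>1)"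
      by (rule decay_along_trajectory[OF _ trajectory_has_integral[OF traj] h h'])
        (use T assms pos dec in auto)
    then have "h (x T) powr (1 - \<gamma>\<^sub>2) * T\<^sub>2 \<le> h (x T\<^sub>1) powr (1 - \<gamma>\<^sub>2) * T\<^sub>2 - T\<^sub>2"
      using T by (simp add: T\<^sub>2_def)
    also have "\<dots> < 0"
      using less1 T by simp
    finally show False
      using T by (simp add: mult_less_0_iff)
  qed
  with k(1) show ?thesis by metis
qed

end
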